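(* Let $c$ be a real or complex number and let $\underline{c}=(c,c,c,\dots)$ be the constant sequence. For all integers $k,m\ge 0$ we have $D_{-m,k,n}(\underline{c})=0$ for $0<n\le m+k$, and for every integer $n\ge0$, $$D_{-m,k,n+m+k+1}(\underline{c})=(-1)^{\binom{m+k+1}{2}}\,D_{m,k,n}(\underline{c}).$$
   Context: For a sequence $\mathbf{s}=(s_k)_{k\ge0}$ define numbers $a_{n,k}(\mathbf{s})$ for $n\ge 0$, $k\in\mathbb{Z}$ by $a_{0,k}(\mathbf{s})=[k=0]$ (i.e. $1$ if $k=0$, else $0$), $a_{n,k}(\mathbf{s})=0$ for $k<0$, and for $n\ge1$, $k\ge 0$: $a_{n,k}(\mathbf{s})=a_{n-1,k-1}(\mathbf{s})+s_k\,a_{n-1,k}(\mathbf{s})+a_{n-1,k+1}(\mathbf{s})$. Extend to all $n\in\mathbb{Z}$ by $a_{n,k}(\mathbf{s})=0$ for $n<0$. For $m\in\mathbb{Z}$, $k\ge0$ and $n\ge 0$ define $D_{m,k,n}(\mathbf{s})=\det\left(a_{i+j+m,k}(\mathbf{s})\right)_{i,j=0}^{n-1}$, with $D_{m,k,0}(\mathbf{s})=1$. *)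

theory Defs
  imports Complex_Main "Jordan_Normal_Form.Determinant"
begin

fun a_nonneg :: "(nat \<Rightarrow> 'a::comm_ring_1) \<Rightarrow> nat \<Rightarrow> int \<Rightarrow> 'a" where
  "a_nonneg s 0 k = (if k = 0 then 1 else 0)"
| "a_nonneg s (Suc n) k =
     (if k < 0 then 0
      else a_nonneg s n (k - 1) + s (nat k) * a_nonneg s n k + a_nonneg s n (k + 1))"

definition a :: "(nat \<Rightarrow> 'a::comm_ring_1) \<Rightarrow> int \<Rightarrow> int \<Rightarrow> 'a" where
  "a s n k = (if n < 0 then 0 else a_nonneg s (nat n) k)"

definition D :: "(nat \<Rightarrow> 'a::comm_ring_1) \<Rightarrow> int \<Rightarrow> nat \<Rightarrow> nat \<Rightarrow> 'a" where
  "D s m k n = det (mat n n (\<lambda>(i, j). a s (int i + int j + m) (int k)))"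

lemma a_0: "a s 0 k = (if k = 0 then 1 else 0)"
  by (simp add: a_def)

lemma a_neg_row: "n < 0 \<Longrightarrow> a s n k = 0"
  by (simp add: a_def)

lemma a_neg_col: "k < 0 \<Longrightarrow> a s n k = 0"
  by (cases "nat n") (auto simp: a_def)

lemma a_rec:
  assumes "n \<ge> 1" "k \<ge> 0"
  shows "a s n k = a s (n - 1) (k - 1) + s (nat k) * a s (n - 1) k + a s (n - 1) (k + 1)"
proof -
  have "nat n = Suc (nat (n - 1))"
    using assms by simp
  then show ?thesis
    using assms by (simp add: a_def)
qed

lemma D_0: "D s m k 0 = 1"
  by (simp add: D_def det_dim_zero)

end

theory Submission
  imports Defs "HOL-Computational_Algebra.Formal_Power_Series"
begin

text \<open>
  Let \<open>F\<close> be the generating function of \<open>a\<^sub>n\<^sub>,\<^sub>0\<close>. For a constant sequence the column generating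
  functions are \<open>x\<^sup>k F\<^sup>k\<^sup>+\<^sup>1\<close>, so \<open>D\<^sub>-\<^sub>m\<^sub>,\<^sub>k\<close> is a Hankel determinant of \<open>x\<^sup>m\<^sup>+\<^sup>k F\<^sup>k\<^sup>+\<^sup>1\<close>. Multiplying
  the Hankel matrix by the unipotent Toeplitz matrix of the inverse series \<open>G\<close> of \<open>F\<^sup>k\<^sup>+\<^sup>1\<close> makes it block
  triangular: one block is an antidiagonal of ones, the other one a unipotent matrix times
  the negated Hankel matrix of the coefficients of \<open>G\<close> of index at least \<open>m + k + 2\<close>. Since
  \<open>1/F\<close> and \<open>x\<^sup>2 F\<close> have the sum \<open>1 - c x\<close> and the product \<open>x\<^sup>2\<close>, the series
  \<open>1/F\<^sup>k\<^sup>+\<^sup>1 + (x\<^sup>2 F)\<^sup>k\<^sup>+\<^sup>1\<close> is a polynomial of degree at most \<open>k + 1\<close>, so these coefficients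
  are those of \<open>-(x\<^sup>2 F)\<^sup>k\<^sup>+\<^sup>1\<close>, and the second block yields \<open>D\<^sub>m\<^sub>,\<^sub>k\<close>.
\<close>

section \<open>Determinants of antidiagonal, Toeplitz and Hankel matrices\<close>

lemma det_antidiagonal:
  "det (mat n n (\<lambda>(i, j). if i + j + 1 = n then 1 else 0) :: 'a::comm_ring_1 mat)
     = (- 1) ^ (n choose 2)"
proof (induction n)
  case 0
  then show ?case by (simp add: det_dim_zero numeral_2_eq_2)
next
  case (Suc n)
  let ?J = "\<lambda>n. mat n n (\<lambda>(i, j). if i + j + 1 = n then 1 else 0) :: 'a mat"
  \<comment> \<open>Row 0 has its only one in column \<open>n\<close>; the cofactor sign there
    accounts for C(n+1, 2) = n + C(n, 2).\<close>
  have minor: "mat_delete (?J (Suc n)) 0 n = ?J n"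
    by (rule eq_matI) (auto simp: mat_delete_def)
  have "det (?J (Suc n)) = (\<Sum>j<Suc n. ?J (Suc n) $$ (0, j) * cofactor (?J (Suc n)) 0 j)"
    by (rule laplace_expansion_row) auto
  also have "\<dots> = (\<Sum>j<Suc n. if j = n then cofactor (?J (Suc n)) 0 j else 0)"
    by (intro sum.cong) auto
  also have "\<dots> = cofactor (?J (Suc n)) 0 n"
    by simp
  also have "\<dots> = (- 1) ^ n * (- 1) ^ (n choose 2)"
    unfolding cofactor_def minor Suc.IH by simp
  also have "\<dots> = (- 1) ^ (Suc n choose 2)"
    by (simp add: power_add numeral_2_eq_2)
  finally show ?case .
qed

lemma det_upper_toeplitz:
  fixes f :: "'a::comm_ring_1 fps"
  assumes "fps_nth f 0 = 1"
  shows "det (mat n n (\<lambda>(i, j). if i \<le> j then fps_nth f (j - i) else 0)) = 1"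
  using assms
  by (subst det_upper_triangular[of _ n]) (auto simp: upper_triangular_def prod_list_diag_prod)

lemma det_lower_toeplitz:
  fixes f :: "'a::comm_ring_1 fps"
  assumes "fps_nth f 0 = 1"
  shows "det (mat n n (\<lambda>(i, j). if j \<le> i then fps_nth f (i - j) else 0)) = 1"
  using assms
  by (subst det_lower_triangular[of n]) (auto simp: prod_list_diag_prod)

text \<open>Used below with \<open>p = m + k\<close> and \<open>B = F ^ (k + 1)\<close>: the shift
  by \<open>p\<close> accounts for \<open>p + 1\<close> antidiagonal rows, and the other
  \<open>n\<close> rows carry the tail of the inverse series.\<close>

lemma det_hankel_inverse:
  fixes B G :: "'a::idom fps"
  assumes inv: "B * G = 1" and B0: "fps_nth B 0 = 1"
  shows "det (mat (p + 1 + n) (p + 1 + n)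
             (\<lambda>(i, j). if i + j < p then 0 else fps_nth B (i + j - p)))
    = (- 1) ^ ((p + 1) choose 2) * det (mat n n (\<lambda>(i, j). - fps_nth G (p + 2 + i + j)))"
proof -
  define N where "N = p + 1 + n"
  define H where "H = mat N N (\<lambda>(i, j). if i + j < p then 0 else fps_nth B (i + j - p))"
  define U where "U = mat N N (\<lambda>(i, j). if i \<le> j then fps_nth G (j - i) else 0)"
  define J :: "'a mat" where
    "J = mat (p + 1) (p + 1) (\<lambda>(i, j). if i + j + 1 = p + 1 then 1 else 0)"
  define L where "L = mat n n (\<lambda>(i, j). if j \<le> i then fps_nth B (i - j) else 0)"
  define K where "K = mat n n (\<lambda>(i, j). - fps_nth G (p + 2 + i + j))"
  define R where "R = mat n (p + 1) (\<lambda>(i, j). (H * U) $$ (p + 1 + i, j))"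
  have carr: "H \<in> carrier_mat N N" "U \<in> carrier_mat N N" "J \<in> carrier_mat (p + 1) (p + 1)"
    "L \<in> carrier_mat n n" "K \<in> carrier_mat n n" "R \<in> carrier_mat n (p + 1)"
    by (auto simp: H_def U_def J_def L_def K_def R_def)
  have G0: "fps_nth G 0 = 1"
    using arg_cong[OF inv, of "\<lambda>f. fps_nth f 0"] B0 by simp
  have conv: "(\<Sum>q\<le>r. fps_nth B q * fps_nth G (r - q)) = (if r = 0 then 1 else 0)" for r
    using arg_cong[OF inv, of "\<lambda>f. fps_nth f r"]
    by (simp add: fps_mult_nth atLeast0AtMost)
  have HU: "(H * U) $$ (i, j) =
      (\<Sum>l\<le>j. if i + l < p then 0 else fps_nth B (i + l - p) * fps_nth G (j - l))"
    if "i < N" "j < N" for i j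
  proof -
    have "(H * U) $$ (i, j) = (\<Sum>l\<in>{0..<N}. if l \<le> j then
        (if i + l < p then 0 else fps_nth B (i + l - p) * fps_nth G (j - l)) else 0)"
      using that unfolding H_def U_def
      by (simp add: scalar_prod_def) (intro sum.cong, auto)
    also have "\<dots> = (\<Sum>l\<in>{0..<N} \<inter> {l. l \<le> j}.
        if i + l < p then 0 else fps_nth B (i + l - p) * fps_nth G (j - l))"
      by (subst sum.inter_restrict) simp_all
    also have "{0..<N} \<inter> {l. l \<le> j} = {..j}"
      using that by auto
    finally show ?thesis .
  qed
  \<comment> \<open>Row \<open>i\<close> of \<open>H\<close> with \<open>i \<le> p\<close> contains
    \<open>B\<close> from its constant term on, starting in column \<open>p - i\<close>, so these
    entries are complete Cauchy coefficients of \<open>B * G = 1\<close>.\<close>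
  have top: "(H * U) $$ (i, j) = (if i + j = p then 1 else 0)" if "i \<le> p" "j < N" for i j
  proof (cases "i + j < p")
    case True
    then show ?thesis
      using that by (subst HU) (auto simp: N_def intro!: sum.neutral)
  next
    case False
    then have j: "p - i \<le> j" by simp
    have "(H * U) $$ (i, j) =
        (\<Sum>l\<in>{p - i..j}. fps_nth B (i + l - p) * fps_nth G (j - l))"
      using that by (subst HU) (auto simp: N_def intro!: sum.mono_neutral_cong_right)
    also have "\<dots> = (\<Sum>q\<le>j - (p - i). fps_nth B q * fps_nth G (j - (p - i) - q))"
      using j that
      by (intro sum.reindex_bij_witness[of _ "\<lambda>q. q + (p - i)" "\<lambda>l. l - (p - i)"])
        (auto simp: add.commute)
    also have "\<dots> = (if i + j = p then 1 else 0)"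
      using j that by (subst conv) auto
    finally show ?thesis .
  qed
  \<comment> \<open>Row \<open>p + 1 + i\<close> starts only at coefficient \<open>i + 1\<close> of
    \<open>B\<close>. The entry is thus the tail of the Cauchy coefficient at \<open>r\<close>,
    which vanishes since \<open>r > 0\<close>; the missing head, negated, is the entry of
    \<open>L * K\<close>.\<close>
  have bottom: "(H * U) $$ (p + 1 + i, p + 1 + j) = (L * K) $$ (i, j)"
    if "i < n" "j < n" for i j
  proof -
    define r where "r = p + 2 + i + j"
    define t where "t = (\<lambda>q. fps_nth B q * fps_nth G (r - q))"
    have "(H * U) $$ (p + 1 + i, p + 1 + j) =
        (\<Sum>l\<le>p + 1 + j. fps_nth B (i + 1 + l) * fps_nth G (p + 1 + j - l))"
      using that by (subst HU) (simp_all add: N_def)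
    also have "\<dots> = sum t {i + 1..r}"
      unfolding t_def r_def
      by (intro sum.reindex_bij_witness[of _ "\<lambda>q. q - (i + 1)" "\<lambda>l. l + (i + 1)"])
        (auto simp: add.commute)
    finally have 1: "(H * U) $$ (p + 1 + i, p + 1 + j) = sum t {i + 1..r}" .
    have "(L * K) $$ (i, j) =
        (\<Sum>l\<in>{0..<n}. if l \<le> i then - (fps_nth B (i - l) * fps_nth G (p + 2 + l + j)) else 0)"
      using that unfolding L_def K_def
      by (auto simp: scalar_prod_def intro!: sum.cong)
    also have "\<dots> = (\<Sum>l\<in>{0..<n} \<inter> {l. l \<le> i}.
        - (fps_nth B (i - l) * fps_nth G (p + 2 + l + j)))"
      by (subst sum.inter_restrict) simp_all
    also have "{0..<n} \<inter> {l. l \<le> i} = {..i}"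
      using that by auto
    also have "(\<Sum>l\<le>i. - (fps_nth B (i - l) * fps_nth G (p + 2 + l + j))) = - sum t {..i}"
      unfolding t_def r_def sum_negf[symmetric]
      by (intro sum.reindex_bij_witness[of _ "\<lambda>q. i - q" "\<lambda>l. i - l"])
        (auto simp: ac_simps)
    finally have 2: "(L * K) $$ (i, j) = - sum t {..i}" .
    have "{..r} = {..i} \<union> {i + 1..r}"
      by (auto simp: r_def)
    then have "sum t {..i} + sum t {i + 1..r} = sum t {..r}"
      by (simp add: sum.union_disjoint)
    also have "\<dots> = 0"
      unfolding t_def by (subst conv) (simp add: r_def)
    finally show ?thesis
      unfolding 1 2 by (simp add: add_eq_0_iff2 add_eq_0_iff)
  qed
  \<comment> \<open>The upper right block is zero because \<open>i + j = p\<close> fails once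
    \<open>j > p\<close>.\<close>
  have "H * U = four_block_mat J (0\<^sub>m (p + 1) n) R (L * K)"
  proof (rule eq_matI)
    fix i j
    assume "i < dim_row (four_block_mat J (0\<^sub>m (p + 1) n) R (L * K))"
      and "j < dim_col (four_block_mat J (0\<^sub>m (p + 1) n) R (L * K))"
    then have ij: "i < N" "j < N"
      using carr by (auto simp: N_def)
    show "(H * U) $$ (i, j) = four_block_mat J (0\<^sub>m (p + 1) n) R (L * K) $$ (i, j)"
    proof (cases "i \<le> p")
      case True
      then show ?thesis
        using ij carr top[OF True ij(2)] by (auto simp: N_def J_def)
    next
      case i: False
      show ?thesis
      proof (cases "j \<le> p")
        case True
        then show ?thesis
          using i ij carr by (auto simp: N_def R_def)
      next
        case False
        then show ?thesis
          using i ij carr bottom[of "i - (p + 1)" "j - (p + 1)"] by (auto simp: N_def)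
      qed
    qed
  qed (use carr in \<open>auto simp: N_def\<close>)
  then have "det (H * U) = det J * det (L * K)"
    using carr by (simp add: det_four_block_mat_upper_right_zero[of J "p + 1" _ n])
  moreover have "det (H * U) = det H"
    using det_mult[OF carr(1,2)] det_upper_toeplitz[OF G0, of N] by (simp add: U_def)
  moreover have "det (L * K) = det K"
    using det_mult[OF carr(4,5)] det_lower_toeplitz[OF B0, of n] by (simp add: L_def)
  moreover have "det J = (- 1) ^ ((p + 1) choose 2)"
    unfolding J_def by (rule det_antidiagonal)
  ultimately show ?thesis
    by (simp add: H_def K_def N_def)
qed

section \<open>Column generating functions of a constant sequence\<close>

definition column_fps :: "(nat \<Rightarrow> 'a::comm_ring_1) \<Rightarrow> nat \<Rightarrow> 'a fps" where
  "column_fps s k = Abs_fps (\<lambda>n. a_nonneg s n (int k))"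

lemma a_nonneg_neg_col: "k < 0 \<Longrightarrow> a_nonneg s n k = 0"
  by (cases n) auto

lemma column_fps_0:
  "column_fps (\<lambda>_. c) 0 = 1 + fps_const c * fps_X * column_fps (\<lambda>_. c) 0
     + fps_X * column_fps (\<lambda>_. c) 1"
proof (rule fps_ext)
  fix n
  show "fps_nth (column_fps (\<lambda>_. c) 0) n = fps_nth (1 + fps_const c * fps_X * column_fps (\<lambda>_. c) 0
     + fps_X * column_fps (\<lambda>_. c) 1) n"
    by (cases n) (simp_all add: column_fps_def mult.assoc a_nonneg_neg_col)
qed

lemma column_fps_Suc:
  "column_fps (\<lambda>_. c) (Suc k) = fps_X * column_fps (\<lambda>_. c) k
     + fps_const c * fps_X * column_fps (\<lambda>_. c) (Suc k)
     + fps_X * column_fps (\<lambda>_. c) (Suc (Suc k))"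
proof (rule fps_ext)
  fix n
  show "fps_nth (column_fps (\<lambda>_. c) (Suc k)) n = fps_nth (fps_X * column_fps (\<lambda>_. c) k
     + fps_const c * fps_X * column_fps (\<lambda>_. c) (Suc k)
     + fps_X * column_fps (\<lambda>_. c) (Suc (Suc k))) n"
    by (cases n) (simp_all add: column_fps_def mult.assoc add.commute)
qed

text \<open>The defects \<open>E k\<close> of the claimed identity satisfy the column recurrence
  without the initial term 1, because constancy of the sequence makes the recurrence invariant under
  shifting \<open>k\<close>. So each \<open>E k\<close> is \<open>fps_X\<close> times a combination
  of defects, and all coefficients vanish by induction on their index, for all \<open>k\<close> at
  once.\<close>

lemma column_fps_step:
  fixes c :: "'a::comm_ring_1"
  shows "column_fps (\<lambda>_. c) (Suc k) = fps_X * column_fps (\<lambda>_. c) 0 * column_fps (\<lambda>_. c) k"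
proof -
  define A where "A = column_fps (\<lambda>_. c)"
  define E where "E = (\<lambda>k. A (Suc k) - fps_X * A 0 * A k)"
  have E_0: "E 0 = fps_X * (fps_const c * E 0 + E 1)"
  proof -
    have "E 0 = fps_X * A 0 + fps_const c * fps_X * A 1 + fps_X * A 2
        - fps_X * A 0 * (1 + fps_const c * fps_X * A 0 + fps_X * A 1)"
      unfolding E_def A_def column_fps_0[of c, symmetric]
      using column_fps_Suc[of c 0] by (simp add: numeral_2_eq_2)
    then show ?thesis
      by (simp add: E_def numeral_2_eq_2 algebra_simps)
  qed
  have E_Suc: "E (Suc k) = fps_X * (E k + fps_const c * E (Suc k) + E (Suc (Suc k)))" for k
  proof -
    have "E (Suc k) = fps_X * A (Suc k) + fps_const c * fps_X * A (Suc (Suc k))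
          + fps_X * A (Suc (Suc (Suc k)))
        - fps_X * A 0 * (fps_X * A k + fps_const c * fps_X * A (Suc k)
          + fps_X * A (Suc (Suc k)))"
      unfolding E_def A_def column_fps_Suc[of c k, symmetric]
        column_fps_Suc[of c "Suc k", symmetric] ..
    then show ?thesis
      by (simp add: E_def algebra_simps)
  qed
  have "fps_nth (E k) n = 0" for n
  proof (induction n arbitrary: k)
    case 0
    show ?case
    proof (cases k)
      case 0
      then show ?thesis
        by (simp, subst E_0) simp
    next
      case (Suc k')
      then show ?thesis
        by (simp, subst E_Suc) simp
    qed
  next
    case (Suc n)
    show ?case
    proof (cases k)
      case 0
      then show ?thesis
        by (simp, subst E_0) (simp add: Suc.IH)
    next
      case (Suc k')
      then show ?thesis
        by (simp, subst E_Suc) (simp add: Suc.IH)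
    qed
  qed
  then have "E k = 0"
    by (simp add: fps_eq_iff)
  then show ?thesis
    by (simp add: E_def A_def)
qed

lemma column_fps_power:
  fixes c :: "'a::comm_ring_1"
  shows "column_fps (\<lambda>_. c) k = fps_X ^ k * column_fps (\<lambda>_. c) 0 ^ (k + 1)"
proof (induction k)
  case (Suc k)
  show ?case
    by (subst column_fps_step, subst Suc.IH) (simp add: algebra_simps)
qed simp

lemma a_eq_fps_nth:
  fixes c :: "'a::comm_ring_1"
  shows "a (\<lambda>_. c) (int n) (int k) =
    (if n < k then 0 else fps_nth (column_fps (\<lambda>_. c) 0 ^ (k + 1)) (n - k))"
proof -
  have "a (\<lambda>_. c) (int n) (int k) = fps_nth (column_fps (\<lambda>_. c) k) n"
    by (simp add: a_def column_fps_def)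
  then show ?thesis
    by (subst (asm) column_fps_power) (simp add: fps_X_power_mult_nth)
qed

section \<open>The inverse of a power of the generating function\<close>

lemma fps_power_sum_degree:
  fixes u v :: "'a::comm_ring_1 fps"
  assumes sum: "u + v = 1 - fps_const c * fps_X" and prod: "u * v = fps_X ^ 2" and "r > j"
  shows "fps_nth (u ^ j + v ^ j) r = 0"
  using \<open>r > j\<close>
proof (induction j arbitrary: r rule: less_induct)
  case (less j)
  consider "j = 0" | "j = 1" | i where "j = Suc (Suc i)"
    by (metis One_nat_def not0_implies_Suc)
  then show ?case
  proof cases
    case 1
    then show ?thesis
      using less.prems by (simp add: numeral_fps_const)
  next
    case 2
    then show ?thesis
      using less.prems by (simp add: sum fps_X_def)
  next
    case (3 i)
    obtain r' where r': "r = Suc (Suc r')"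
      using less.prems 3 by (metis Suc_lessE)
    \<comment> \<open>Newton's recurrence for power sums: the factor \<open>u + v\<close> raises the
      degree by at most one, and \<open>u * v\<close> by two while the exponent drops by
      two.\<close>
    have "u ^ j + v ^ j = (u + v) * (u ^ Suc i + v ^ Suc i) - u * v * (u ^ i + v ^ i)"
      unfolding 3 by (simp add: algebra_simps)
    also have "\<dots> = (u ^ Suc i + v ^ Suc i) - fps_X * (fps_const c * (u ^ Suc i + v ^ Suc i))
        - fps_X * (fps_X * (u ^ i + v ^ i))"
      unfolding sum prod by (simp add: algebra_simps power2_eq_square)
    finally have eq: "u ^ j + v ^ j = (u ^ Suc i + v ^ Suc i)
        - fps_X * (fps_const c * (u ^ Suc i + v ^ Suc i)) - fps_X * (fps_X * (u ^ i + v ^ i))" .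
    have ih: "fps_nth (u ^ Suc i + v ^ Suc i) r = 0"
        "fps_nth (u ^ Suc i + v ^ Suc i) (Suc r') = 0" "fps_nth (u ^ i + v ^ i) r' = 0"
      using less.prems 3 r' by (intro less.IH; simp)+
    show ?thesis
      unfolding eq fps_sub_nth using ih
      by (simp only: r' fps_X_mult_nth fps_mult_left_const_nth) simp
  qed
qed

lemma fps_nth_inverse_column_power:
  fixes c :: "'a::comm_ring_1"
  defines "F \<equiv> column_fps (\<lambda>_. c) 0"
  obtains G where "F ^ (k + 1) * G = 1"
    and "\<And>r. fps_nth G (k + 2 + r) = - a (\<lambda>_. c) (int r) (int k)"
proof -
  \<comment> \<open>The quadratic equation F = 1 + cXF + X^2 F^2 makes this the inverse of
    \<open>F\<close>, with no division in the coefficient ring.\<close>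
  define u where "u = 1 - fps_const c * fps_X - fps_X ^ 2 * F"
  define v where "v = fps_X ^ 2 * F"
  have "F = 1 + fps_const c * fps_X * F + fps_X * (fps_X * F * F)"
    using column_fps_0[of c] column_fps_step[of c 0] by (simp add: F_def)
  then have Fu: "F * u = 1"
    by (simp add: u_def algebra_simps power2_eq_square)
  have "u * v = fps_X ^ 2 * (F * u)"
    by (simp add: v_def)
  then have prod: "u * v = fps_X ^ 2"
    by (simp add: Fu)
  have sum: "u + v = 1 - fps_const c * fps_X"
    by (simp add: u_def v_def)
  show thesis
  proof
    show "F ^ (k + 1) * u ^ (k + 1) = 1"
      unfolding power_mult_distrib[symmetric] Fu by simp
    fix r
    \<comment> \<open>Index \<open>k + 2\<close> is the first beyond the degree bound
      \<open>k + 1\<close>.\<close>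
    have "fps_nth (u ^ (k + 1)) (k + 2 + r) = - fps_nth (v ^ (k + 1)) (k + 2 + r)"
      using fps_power_sum_degree[OF sum prod, of "k + 1" "k + 2 + r"]
      by (simp add: add_eq_0_iff2)
    also have "v ^ (k + 1) = fps_X ^ (k + 2) * (fps_X ^ k * F ^ (k + 1))"
      by (simp add: v_def power_mult_distrib power_mult[symmetric] power_add[symmetric]
          mult.assoc[symmetric] mult_2 del: power_Suc)
    also have "fps_nth \<dots> (k + 2 + r) = a (\<lambda>_. c) (int r) (int k)"
      unfolding fps_X_power_mult_nth a_eq_fps_nth F_def by simp
    finally show "fps_nth (u ^ (k + 1)) (k + 2 + r) = - a (\<lambda>_. c) (int r) (int k)" .
  qed
qed

section \<open>Hankel determinants with negative shift\<close>

lemma D_minus_eq_hankel: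
  fixes c :: "'a::comm_ring_1"
  shows "D (\<lambda>_. c) (- int m) k n = det (mat n n (\<lambda>(i, j).
    if i + j < m + k then 0 else fps_nth (column_fps (\<lambda>_. c) 0 ^ (k + 1)) (i + j - (m + k))))"
proof -
  have "a (\<lambda>_. c) (int i + int j + - int m) (int k) = (if i + j < m + k then 0
      else fps_nth (column_fps (\<lambda>_. c) 0 ^ (k + 1)) (i + j - (m + k)))" for i j
  \<comment> \<open>Entries with \<open>i + j < m\<close> vanish by the convention for negative
    rows, those with \<open>m \<le> i + j < m + k\<close> because column \<open>k\<close> starts at
    row \<open>k\<close>.\<close>
  proof (cases "i + j < m")
    case True
    then show ?thesis by (simp add: a_def)
  next
    case False
    then have "int i + int j + - int m = int (i + j - m)"
      by simp
    moreover have "i + j - m < k \<longleftrightarrow> i + j < m + k" "i + j - m - k = i + j - (m + k)"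
      using False by auto
    ultimately show ?thesis
      by (simp only: a_eq_fps_nth)
  qed
  then show ?thesis
    by (simp add: D_def)
qed

theorem theorem2:
  fixes c :: "'a::real_normed_field" and k m :: nat
  shows "(\<forall>n::nat. 0 < n \<and> n \<le> m + k \<longrightarrow> D (\<lambda>_. c) (- int m) k n = 0) \<and>
         (\<forall>n::nat. D (\<lambda>_. c) (- int m) k (n + m + k + 1) =
            (- 1) ^ ((m + k + 1) choose 2) * D (\<lambda>_. c) (int m) k n)"
proof (intro conjI allI impI)
  fix n :: nat
  assume n: "0 < n \<and> n \<le> m + k"
  \<comment> \<open>The first row is zero: its columns satisfy
    \<open>j < n \<le> m + k\<close>.\<close>
  then show "D (\<lambda>_. c) (- int m) k n = 0"
    unfolding D_minus_eq_hankel
    by (subst laplace_expansion_row[of _ n 0]) (auto intro!: sum.neutral)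
next
  fix n :: nat
  define F where "F = column_fps (\<lambda>_. c) 0"
  obtain G where G: "F ^ (k + 1) * G = 1"
    and G_nth: "\<And>r. fps_nth G (k + 2 + r) = - a (\<lambda>_. c) (int r) (int k)"
    using fps_nth_inverse_column_power[of c k] unfolding F_def by blast
  have F0: "fps_nth (F ^ (k + 1)) 0 = 1"
    by (simp add: F_def column_fps_def fps_power_zeroth)
  \<comment> \<open>The shift changes sign here: index \<open>p + 2 + i + j\<close> with
    \<open>p = m + k\<close> is \<open>k + 2 + r\<close> for \<open>r = m + i + j\<close>.\<close>
  have "- fps_nth G (m + k + 2 + i + j) = a (\<lambda>_. c) (int i + int j + int m) (int k)" for i j
    using G_nth[of "m + i + j"] by (simp add: algebra_simps)
  then show "D (\<lambda>_. c) (- int m) k (n + m + k + 1) =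
      (- 1) ^ ((m + k + 1) choose 2) * D (\<lambda>_. c) (int m) k n"
    using det_hankel_inverse[OF G F0, of "m + k" n]
    unfolding D_minus_eq_hankel F_def by (simp add: D_def add.commute add.left_commute)
qed

end
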